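(* Let $n$ be a non-negative integer and $p$ an odd prime. For all $k\in\mathbb{Z}$, the following hold. (i) Suppose $p\ge 2n+5$. The congruence $$\binom{kp-1}{p-1}\equiv \sum_{j=0}^{n} b_{j,n}(k)\,p^j H(\{1\}^j;p-1)\pmod{p^{2n+4}}$$ holds if and only if either $k\equiv 0 \pmod p$, or $k\equiv 1\pmod p$, or $p$ divides the numerator of the Bernoulli number $B_{p-2n-3}$. (ii) Suppose $p=2n+3$. The congruence $$\binom{kp-1}{p-1}\equiv \sum_{j=0}^{n} b_{j,n}(k)\,p^j H(\{1\}^j;p-1)\pmod{p^{2n+3}}$$ holds if and only if $k\equiv 0\pmod p$ or $k\equiv 1\pmod p$.
   Context: For non-negative integers $j,m$, the elementary symmetric multiple harmonic sum is $H(\{1\}^j;m)=\sum_{m\ge i_1>i_2>\cdots>i_j\ge 1}\frac{1}{i_1 i_2\cdots i_j}\in\mathbb{Q}$, with $H(\{1\}^0;m)=1$ and $H(\{1\}^j;m)=0$ if $j>m$. For integers $0\le j\le n$, the extremal polynomial $b_{j,n}(T)\in\mathbb{Q}[T]$ is the unique polynomial of degree at most $2n+1$ satisfying $b_{j,n}(T)\equiv (T-1)^j \pmod{(T-1)^{n+1}}$ and $b_{j,n}(T)\equiv (-1)^jT^j\pmod{T^{n+1}}$ in $\mathbb{Q}[T]$ (these polynomials have integer coefficients). For an arbitrary integer $x$, $\binom{x}{m}=x(x-1)\cdots(x-m+1)/m!$. The Bernoulli numbers are given by $\frac{t}{e^t-1}=\sum_{m\ge0}B_m\frac{t^m}{m!}$.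 Congruences modulo $p^m$ are between rational numbers with denominators prime to $p$: $x\equiv y\pmod{p^m}$ means $x-y$ has $p$-adic valuation at least $m$. *)

theory Defs
  imports "HOL-Number_Theory.Number_Theory" "HOL-Computational_Algebra.Computational_Algebra"
begin

text \<open>The sequences \<open>m \<ge> i\<^sub>1 > i\<^sub>2 > \<dots> > i\<^sub>j \<ge> 1\<close> are encoded as strictly decreasing lists.\<close>

definition elem_harmonic :: "nat \<Rightarrow> nat \<Rightarrow> rat" where
  "elem_harmonic j m =
     (\<Sum>is | length is = j \<and> sorted_wrt (>) is \<and> set is \<subseteq> {1..m}. \<Prod>i\<leftarrow>is. 1 / of_nat i)"

lemma finite_elem_harmonic_index:
  "finite {is. length is = j \<and> sorted_wrt (>) is \<and> set is \<subseteq> {1..m::nat}}"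
  by (rule finite_subset[OF _ finite_lists_length_eq[of "{1..m}" j]]) auto

lemma elem_harmonic_0 [simp]: "elem_harmonic 0 m = 1"
proof -
  have "{is. length is = 0 \<and> sorted_wrt (>) is \<and> set is \<subseteq> {1..m}} = {[]}" by auto
  then show ?thesis unfolding elem_harmonic_def by simp
qed

lemma elem_harmonic_eq_0:
  assumes "j > m"
  shows "elem_harmonic j m = 0"
proof -
  have "length is \<le> m" if "sorted_wrt (>) is" "set is \<subseteq> {1..m}" for "is" :: "nat list"
  proof -
    have "distinct is"
      using that(1) by (induction "is") auto
    then have "length is = card (set is)" by (simp add: distinct_card)
    also have "\<dots> \<le> card {1..m}" using that(2) by (intro card_mono) auto
    finally show ?thesis by simp
  qed
  then have "{is. length is = j \<and> sorted_wrt (>) is \<and> set is \<subseteq> {1..m}} = {}"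
    using assms by fastforce
  then show ?thesis unfolding elem_harmonic_def by (simp only: sum.empty)
qed


definition is_extremal_poly :: "nat \<Rightarrow> nat \<Rightarrow> rat poly \<Rightarrow> bool" where
  "is_extremal_poly j n b \<longleftrightarrow>
     degree b \<le> 2 * n + 1 \<and>
     [b = [:-1, 1:] ^ j] (mod [:-1, 1:] ^ (n + 1)) \<and>
     [b = (-1) ^ j * [:0, 1:] ^ j] (mod [:0, 1:] ^ (n + 1))"

definition extremal_poly :: "nat \<Rightarrow> nat \<Rightarrow> rat poly" where
  "extremal_poly j n = (THE b. is_extremal_poly j n b)"

lemma bezout_pow_left:
  fixes x y :: "'a :: comm_ring_1"
  assumes "u * x + v * y = 1"
  shows "\<exists>u v. u * x ^ N + v * y = 1"
proof -
  have "u * x - 1 dvd (u * x) ^ N - 1"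
    by (metis dvd_triv_left power_diff_1_eq)
  moreover have "u * x - 1 = y * (- v)" using assms by (simp add: algebra_simps)
  ultimately have "y dvd (u * x) ^ N - 1" by (metis dvd_mult_left)
  then obtain w where "(u * x) ^ N - 1 = y * w" by (auto simp: dvd_def)
  then have "u ^ N * x ^ N + (- w) * y = 1" by (simp add: algebra_simps power_mult_distrib)
  then show ?thesis by blast
qed

lemma bezout_interpolation:
  fixes x y :: "'a :: comm_ring_1"
  assumes "v * y + u * x = 1"
  shows "y dvd a * (u * x) + b * (v * y) - a" "x dvd a * (u * x) + b * (v * y) - b"
proof -
  have ux: "u * x = 1 - v * y" and vy: "v * y = 1 - u * x"
    using assms by (simp_all add: algebra_simps)
  have "a * (u * x) + b * (v * y) - a = y * (v * (b - a))"
    unfolding ux by (simp add: algebra_simps)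
  then show "y dvd a * (u * x) + b * (v * y) - a" by (metis dvd_triv_left)
  have "a * (u * x) + b * (v * y) - b = x * (u * (a - b))"
    unfolding vy by (simp add: algebra_simps)
  then show "x dvd a * (u * x) + b * (v * y) - b" by (metis dvd_triv_left)
qed

lemma bezout_mult_dvd:
  fixes x y :: "'a :: comm_ring_1"
  assumes "v * y + u * x = 1" "x dvd d" "y dvd d"
  shows "x * y dvd d"
proof -
  have "d = v * (d * y) + u * (x * d)"
    using arg_cong[OF assms(1), of "\<lambda>z. d * z"] by (simp add: algebra_simps)
  moreover have "x * y dvd d * y" "x * y dvd x * d"
    using assms(2,3) by (simp_all add: mult_dvd_mono)
  ultimately show ?thesis by (metis dvd_add dvd_mult)
qed

lemma ex1_extremal_poly: "\<exists>!b. is_extremal_poly j n b"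
proof -
  let ?N = "n + 1"
  let ?x = "[:0, 1:] :: rat poly" and ?y = "[:-1, 1:] :: rat poly"
  let ?M = "?x ^ ?N * ?y ^ ?N"
  have deg_M: "degree ?M = 2 * n + 2"
    by (subst degree_mult_eq) (simp_all add: degree_power_eq del: power_Suc)
  have M0: "?M \<noteq> 0" using deg_M by auto
  have "1 * ?x + (-1) * ?y = 1" by (simp add: one_pCons)
  from bezout_pow_left[OF this, of ?N] obtain u v where "v * ?y + u * ?x ^ ?N = 1"
    by (metis add.commute)
  from bezout_pow_left[OF this, of ?N] obtain u v where uv: "v * ?y ^ ?N + u * ?x ^ ?N = 1"
    by blast
  define c where "c = (?y ^ j) * (u * ?x ^ ?N) + ((-1) ^ j * ?x ^ j) * (v * ?y ^ ?N)"
  define b where "b = c mod ?M"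
  have M_dvd: "?M dvd b - c"
    unfolding b_def by (metis cong_iff_dvd_diff cong_mod_left cong_refl)
  have 1: "?y ^ ?N dvd c - ?y ^ j" and 2: "?x ^ ?N dvd c - (-1) ^ j * ?x ^ j"
    unfolding c_def by (rule bezout_interpolation[OF uv])+
  have "?y ^ ?N dvd (b - c) + (c - ?y ^ j)" "?x ^ ?N dvd (b - c) + (c - (-1) ^ j * ?x ^ j)"
    using 1 2 M_dvd by (meson dvd_add dvd_mult_left dvd_mult_right)+
  then have "?y ^ ?N dvd b - ?y ^ j" "?x ^ ?N dvd b - (-1) ^ j * ?x ^ j" by simp_all
  moreover have "degree b \<le> 2 * n + 1"
    using degree_mod_less'[OF M0, of c] deg_M unfolding b_def by fastforce
  ultimately have ex: "is_extremal_poly j n b"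
    unfolding is_extremal_poly_def cong_iff_dvd_diff by blast
  have "a = b" if "is_extremal_poly j n a" for a
  proof (rule ccontr)
    assume "a \<noteq> b"
    have "[a = b] (mod ?y ^ ?N)" "[a = b] (mod ?x ^ ?N)"
      using that ex unfolding is_extremal_poly_def by (meson cong_sym cong_trans)+
    then have "?y ^ ?N dvd a - b" "?x ^ ?N dvd a - b" by (simp_all only: cong_iff_dvd_diff)
    then have "?M dvd a - b" by (intro bezout_mult_dvd[OF uv])
    then have "degree ?M \<le> degree (a - b)" using \<open>a \<noteq> b\<close> by (intro dvd_imp_degree_le) auto
    also have "\<dots> \<le> 2 * n + 1"
      using that ex by (intro degree_diff_le) (simp_all only: is_extremal_poly_def)
    finally show False unfolding deg_M by simp
  qed
  with ex show ?thesis by blast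
qed

lemma is_extremal_poly_extremal_poly: "is_extremal_poly j n (extremal_poly j n)"
  unfolding extremal_poly_def by (rule theI'[OF ex1_extremal_poly])


text \<open>The Bernoulli numbers, read off from \<open>t / (e\<^sup>t - 1) = (\<Sum>m. B\<^sub>m t\<^sup>m / m!)\<close>. The divisor has zero
  constant coefficient, so the quotient is not the product with an inverse series; the lemma below
  confirms that it is the expected one.\<close>

definition bernoulli_fps :: "rat fps" where
  "bernoulli_fps = fps_X / (fps_exp 1 - 1)"

definition bernoulli_number :: "nat \<Rightarrow> rat" where
  "bernoulli_number m = fact m * fps_nth bernoulli_fps m"

lemma bernoulli_fps_mult: "bernoulli_fps * (fps_exp 1 - 1) = fps_X"
proof -
  have "fps_exp 1 - 1 \<noteq> (0 :: rat fps)"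
    by (auto simp: fps_eq_iff intro!: exI[of _ 1])
  moreover have "subdegree (fps_exp 1 - 1 :: rat fps) = 1"
    by (intro subdegreeI) auto
  ultimately have "fps_exp 1 - 1 dvd (fps_X :: rat fps)" by (simp add: fps_dvd_iff)
  then show ?thesis unfolding bernoulli_fps_def by simp
qed


text \<open>\<open>quotient_of x\<close> is the reduced fraction of \<open>x\<close> with positive denominator. The valuation of \<open>0\<close> is
  infinite, which is why the congruence treats equality separately.\<close>

definition rat_numerator :: "rat \<Rightarrow> int" where
  "rat_numerator x = fst (quotient_of x)"

definition rat_denominator :: "rat \<Rightarrow> int" where
  "rat_denominator x = snd (quotient_of x)"

definition padic_val :: "nat \<Rightarrow> rat \<Rightarrow> int" where
  "padic_val p x =
     int (multiplicity (int p) (rat_numerator x)) - int (multiplicity (int p) (rat_denominator x))"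

definition rat_cong :: "nat \<Rightarrow> nat \<Rightarrow> rat \<Rightarrow> rat \<Rightarrow> bool" where
  "rat_cong p m x y \<longleftrightarrow>
     coprime (rat_denominator x) (int p) \<and> coprime (rat_denominator y) (int p) \<and>
     (x = y \<or> padic_val p (x - y) \<ge> int m)"

end

theory Submission
  imports Defs
begin

text \<open>
  Let \<open>H\<^sub>j = H({1}\<^sup>j; p - 1)\<close>. The binomial coefficient is the value at \<open>T = k\<close> of
  \<open>F(T) = (\<Prod>0<i<p. 1 - T p / i)\<close>. The substitution \<open>i \<mapsto> p - i\<close> shows that
  \<open>F(T) = (\<Sum>j. (-p)\<^sup>j H\<^sub>j T\<^sup>j) = (\<Sum>j. p\<^sup>j H\<^sub>j (T - 1)\<^sup>j)\<close>, so the difference of \<open>F\<close> and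
  \<open>\<Sum>j\<le>n. b\<^bsub>j,n\<^esub>(T) p\<^sup>j H\<^sub>j\<close> is a multiple of the monic polynomial \<open>(T (T - 1))\<^bsup>n+1\<^esup>\<close>. Since the subtracted
  sum has degree at most \<open>2n + 1\<close>, the quotient is determined by the coefficients of \<open>F\<close> of degree
  at least \<open>2n + 2\<close>; modulo the given power of \<open>p\<close> it is the constant
  \<open>p\<^bsup>2n+2\<^esup> H\<^bsub>2n+2\<^esub>\<close>. If \<open>p = 2n + 3\<close>, then
  \<open>H\<^bsub>2n+2\<^esub> = 1 / (p - 1)!\<close> is a unit. Otherwise, put \<open>u\<^sub>r = (p - 1)! H\<^bsub>p-1-r\<^esub>\<close>. The functional equation
  \<open>(x + 1) h(x + 1) = (x + p) h(x)\<close> of \<open>h(x) = (\<Prod>0<i<p. 1 + x / i)\<close> gives a recursion for the \<open>u\<^sub>r\<close> which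
  modulo \<open>p\<^sup>2\<close> is the recursion of the Bernoulli numbers, whence
  \<open>r u\<^sub>r \<equiv> - (-1)\<^sup>r p B\<^sub>r (mod p\<^sup>2)\<close> for \<open>0 < r < p - 1\<close>; take \<open>r = p - 2n - 3\<close>.
\<close>

subsection \<open>Localization at a prime\<close>

text \<open>\<open>padic_ideal p m\<close> is \<open>p\<^sup>m \<int>\<^bsub>(p)\<^esub>\<close>, where \<open>\<int>\<^bsub>(p)\<^esub>\<close> is the localization of the integers at \<open>p\<close>.\<close>

definition padic_ideal :: "nat \<Rightarrow> nat \<Rightarrow> rat set" where
  "padic_ideal p m = {x. \<exists>a b. \<not> int p dvd b \<and> x = of_nat p ^ m * of_int a / of_int b}"

lemma padic_idealI:
  "\<not> int p dvd b \<Longrightarrow> x = of_nat p ^ m * of_int a / of_int b \<Longrightarrow> x \<in> padic_ideal p m"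
  unfolding padic_ideal_def by blast

lemma padic_idealE:
  assumes "x \<in> padic_ideal p m"
  obtains a b where "\<not> int p dvd b" "b \<noteq> 0" "x = of_nat p ^ m * of_int a / of_int b"
  using assms unfolding padic_ideal_def by auto

lemma padic_ideal_mult:
  assumes "prime p" "x \<in> padic_ideal p m" "y \<in> padic_ideal p l"
  shows "x * y \<in> padic_ideal p (m + l)"
proof -
  obtain a b where x: "\<not> int p dvd b" "x = of_nat p ^ m * of_int a / of_int b"
    using assms(2) by (elim padic_idealE)
  obtain c d where y: "\<not> int p dvd d" "y = of_nat p ^ l * of_int c / of_int d"
    using assms(3) by (elim padic_idealE)
  have "\<not> int p dvd b * d"
    using x y assms(1) by (simp add: prime_dvd_mult_iff)
  then show ?thesis
    by (rule padic_idealI[where a = "a * c"]) (simp add: x y power_add)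
qed

lemma padic_ideal_add:
  assumes "prime p" "x \<in> padic_ideal p m" "y \<in> padic_ideal p m"
  shows "x + y \<in> padic_ideal p m"
proof -
  obtain a b where x: "\<not> int p dvd b" "b \<noteq> 0" "x = of_nat p ^ m * of_int a / of_int b"
    using assms(2) by (elim padic_idealE)
  obtain c d where y: "\<not> int p dvd d" "d \<noteq> 0" "y = of_nat p ^ m * of_int c / of_int d"
    using assms(3) by (elim padic_idealE)
  have "\<not> int p dvd b * d"
    using x y assms(1) by (simp add: prime_dvd_mult_iff)
  then show ?thesis
    by (rule padic_idealI[where a = "a * d + c * b"]) (use x y in \<open>simp add: field_simps\<close>)
qed

lemma of_int_in_padic_ideal: "prime p \<Longrightarrow> int p ^ m dvd a \<Longrightarrow> of_int a \<in> padic_ideal p m"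
  by (rule padic_idealI[where a = "a div int p ^ m" and b = 1])
     (use not_prime_1 in \<open>auto simp: dvd_def zmult_eq_1_iff\<close>)

lemma of_int_in_padic_ideal_0: "prime p \<Longrightarrow> of_int a \<in> padic_ideal p 0"
  by (rule of_int_in_padic_ideal) simp_all

lemma of_nat_in_padic_ideal_0: "prime p \<Longrightarrow> of_nat a \<in> padic_ideal p 0"
  using of_int_in_padic_ideal_0[of p "int a"] by simp

lemma zero_in_padic_ideal: "prime p \<Longrightarrow> 0 \<in> padic_ideal p m"
  using of_int_in_padic_ideal[of p m 0] by simp

lemma prime_power_in_padic_ideal: "prime p \<Longrightarrow> of_nat p ^ m \<in> padic_ideal p m"
  using of_int_in_padic_ideal[of p m "int p ^ m"] by simp

lemma padic_ideal_mult_left: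
  "prime p \<Longrightarrow> x \<in> padic_ideal p 0 \<Longrightarrow> y \<in> padic_ideal p m \<Longrightarrow> x * y \<in> padic_ideal p m"
  using padic_ideal_mult[of p x 0 y m] by simp

lemma padic_ideal_mult_right:
  "prime p \<Longrightarrow> x \<in> padic_ideal p m \<Longrightarrow> y \<in> padic_ideal p 0 \<Longrightarrow> x * y \<in> padic_ideal p m"
  using padic_ideal_mult[of p x m y 0] by simp

lemma padic_ideal_uminus:
  "prime p \<Longrightarrow> x \<in> padic_ideal p m \<Longrightarrow> - x \<in> padic_ideal p m"
  using padic_ideal_mult_left[of p "-1" x m] of_int_in_padic_ideal_0[of p "-1"] by simp

lemma padic_ideal_diff:
  "prime p \<Longrightarrow> x \<in> padic_ideal p m \<Longrightarrow> y \<in> padic_ideal p m \<Longrightarrow> x - y \<in> padic_ideal p m"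
  using padic_ideal_add[of p x m "- y"] padic_ideal_uminus[of p y m] by simp

lemma padic_ideal_sum:
  assumes "prime p" "\<And>i. i \<in> A \<Longrightarrow> f i \<in> padic_ideal p m"
  shows "sum f A \<in> padic_ideal p m"
  using assms(2)
  by (induction A rule: infinite_finite_induct)
     (auto intro: padic_ideal_add assms(1) zero_in_padic_ideal)

lemma padic_ideal_power_0:
  "prime p \<Longrightarrow> x \<in> padic_ideal p 0 \<Longrightarrow> x ^ i \<in> padic_ideal p 0"
  by (induction i) (use of_int_in_padic_ideal_0[of p 1] in \<open>auto intro: padic_ideal_mult_left\<close>)

lemma padic_ideal_mono:
  assumes "prime p" "x \<in> padic_ideal p m" "l \<le> m"
  shows "x \<in> padic_ideal p l"
proof -
  obtain a b where x: "\<not> int p dvd b" "x = of_nat p ^ m * of_int a / of_int b"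
    using assms(2) by (elim padic_idealE)
  show ?thesis
    by (rule padic_idealI[OF x(1), where a = "int p ^ (m - l) * a"])
       (use assms(3) in \<open>simp add: x(2) flip: power_add mult.assoc\<close>)
qed

lemma padic_ideal_divide_unit:
  assumes "prime p" "x \<in> padic_ideal p m" "\<not> int p dvd c"
  shows "x / of_int c \<in> padic_ideal p m"
proof -
  obtain a b where x: "\<not> int p dvd b" "x = of_nat p ^ m * of_int a / of_int b"
    using assms(2) by (elim padic_idealE)
  have "\<not> int p dvd b * c" using x assms by (simp add: prime_dvd_mult_iff)
  then show ?thesis by (rule padic_idealI[where a = a]) (simp add: x)
qed

lemma padic_ideal_unit_mult_iff:
  assumes "prime p" "\<not> int p dvd c"
  shows "of_int c * x \<in> padic_ideal p m \<longleftrightarrow> x \<in> padic_ideal p m"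
proof
  assume "of_int c * x \<in> padic_ideal p m"
  then have "of_int c * x / of_int c \<in> padic_ideal p m"
    by (intro padic_ideal_divide_unit assms)
  then show "x \<in> padic_ideal p m" using assms(2) by (cases "c = 0") auto
next
  assume "x \<in> padic_ideal p m"
  then show "of_int c * x \<in> padic_ideal p m"
    by (intro padic_ideal_mult_left assms of_int_in_padic_ideal_0)
qed

lemma padic_ideal_prime_power_mult_iff:
  assumes "prime p"
  shows "of_nat p ^ l * x \<in> padic_ideal p (l + m) \<longleftrightarrow> x \<in> padic_ideal p m"
proof
  assume "of_nat p ^ l * x \<in> padic_ideal p (l + m)"
  then obtain a b where "\<not> int p dvd b"
    and eq: "of_nat p ^ l * x = of_nat p ^ (l + m) * of_int a / of_int b"
    by (elim padic_idealE)
  moreover have "x = of_nat p ^ m * of_int a / of_int b"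
  proof -
    have "of_nat p ^ l * x = of_nat p ^ l * (of_nat p ^ m * of_int a / of_int b)"
      using eq by (simp add: power_add mult.assoc)
    then show ?thesis using prime_gt_0_nat[OF assms] by (simp only: mult_cancel_left) simp
  qed
  ultimately show "x \<in> padic_ideal p m" by (intro padic_idealI)
next
  assume "x \<in> padic_ideal p m"
  then show "of_nat p ^ l * x \<in> padic_ideal p (l + m)"
    by (intro padic_ideal_mult prime_power_in_padic_ideal assms)
qed

lemma padic_ideal_prime_mult_iff:
  "prime p \<Longrightarrow> of_nat p * x \<in> padic_ideal p (Suc m) \<longleftrightarrow> x \<in> padic_ideal p m"
  using padic_ideal_prime_power_mult_iff[of p 1 x m] by simp

text \<open>An element of the ideal may be added or removed freely. This is how the main proof
  replaces one side of a membership statement by a congruent one.\<close>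

lemma padic_ideal_cong:
  assumes "prime p" "x - y \<in> padic_ideal p m"
  shows "x \<in> padic_ideal p m \<longleftrightarrow> y \<in> padic_ideal p m"
  using padic_ideal_add[OF assms(1,2), of y] padic_ideal_diff[OF assms(1) _ assms(2), of x] by auto

section \<open>Reduced fractions and the congruence relation\<close>

lemma rat_eq_numerator_divide_denominator:
  "x = of_int (rat_numerator x) / of_int (rat_denominator x)"
  unfolding rat_numerator_def rat_denominator_def by (rule quotient_of_div) (rule surjective_pairing)

lemma coprime_numerator_denominator: "coprime (rat_numerator x) (rat_denominator x)"
  unfolding rat_numerator_def rat_denominator_def by (rule quotient_of_coprime) (rule surjective_pairing)

lemma rat_denominator_pos: "rat_denominator x > 0"
  unfolding rat_denominator_def by (rule quotient_of_denom_pos) (rule surjective_pairing)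

lemma padic_ideal_iff:
  assumes "prime p"
  shows "x \<in> padic_ideal p m \<longleftrightarrow>
    \<not> int p dvd rat_denominator x \<and> int p ^ m dvd rat_numerator x"
proof
  let ?n = "rat_numerator x" and ?d = "rat_denominator x"
  have p: "prime (int p)" using assms by simp
  {
    assume "x \<in> padic_ideal p m"
    then obtain a b where b: "\<not> int p dvd b" "b \<noteq> 0" "x = of_nat p ^ m * of_int a / of_int b"
      by (elim padic_idealE)
    have "of_int ?n / of_int ?d = (of_int (int p ^ m * a) / of_int b :: rat)"
      using b(3) rat_eq_numerator_divide_denominator[of x] by simp
    then have "of_int (?n * b) = (of_int (int p ^ m * a * ?d) :: rat)"
      using b(2) rat_denominator_pos[of x] by (simp add: frac_eq_eq)
    \<comment> \<open>Cross-multiplied, the identity lives in the integers. A factor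
      \<open>p\<close> of the denominator would then divide the numerator too, against
      coprimality.\<close>
    then have eq: "?n * b = int p ^ m * a * ?d" by (simp only: of_int_eq_iff)
    have "\<not> int p dvd ?d"
    proof
      assume *: "int p dvd ?d"
      then have "int p dvd ?n * b" unfolding eq by simp
      then have "int p dvd ?n" using b(1) p by (simp add: prime_dvd_mult_iff)
      with * show False
        using coprime_common_divisor[OF coprime_numerator_denominator[of x], of "int p"] p
          not_prime_unit[of "int p"] by simp
    qed
    moreover have "int p ^ m dvd ?n * b" unfolding eq by simp
    then have "int p ^ m dvd ?n"
      using prime_imp_coprime[OF p b(1)] by (simp add: coprime_dvd_mult_left_iff)
    ultimately show "\<not> int p dvd ?d \<and> int p ^ m dvd ?n" by blast
  next
    assume *: "\<not> int p dvd ?d \<and> int p ^ m dvd ?n"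
    then have "of_int ?n / of_int ?d \<in> padic_ideal p m"
      by (intro padic_ideal_divide_unit of_int_in_padic_ideal assms) auto
    then show "x \<in> padic_ideal p m" using rat_eq_numerator_divide_denominator[of x] by simp
  }
qed

text \<open>For a nonzero difference, the valuation bound is read off from the multiplicity of
  \<open>p\<close> in the reduced numerator, since the reduced denominator is prime to
  \<open>p\<close>. Zero lies in every ideal.\<close>

lemma rat_cong_iff_padic_ideal:
  assumes "prime p" "x \<in> padic_ideal p 0" "y \<in> padic_ideal p 0"
  shows "rat_cong p m x y \<longleftrightarrow> x - y \<in> padic_ideal p m"
proof -
  let ?z = "x - y"
  have p: "prime (int p)" using assms by simp
  have cop: "coprime (rat_denominator w) (int p)" if "w \<in> padic_ideal p 0" for w
    using that p prime_imp_coprime[of "int p" "rat_denominator w"]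
    unfolding padic_ideal_iff[OF assms(1)] by (simp add: coprime_commute)
  have z0: "?z \<in> padic_ideal p 0" using assms by (intro padic_ideal_diff)
  have *: "padic_val p ?z \<ge> int m \<longleftrightarrow> ?z \<in> padic_ideal p m" if "x \<noteq> y"
  proof -
    have "rat_numerator ?z \<noteq> 0"
      using that rat_eq_numerator_divide_denominator[of ?z] by auto
    moreover have "multiplicity (int p) (rat_denominator ?z) = 0"
      using z0 unfolding padic_ideal_iff[OF assms(1)] by (simp add: not_dvd_imp_multiplicity_0)
    ultimately show ?thesis
      using z0 prime_gt_1_nat[OF assms(1)] power_dvd_iff_le_multiplicity[of "rat_numerator ?z" "int p" m]
      unfolding padic_ideal_iff[OF assms(1)] padic_val_def by auto
  qed
  show ?thesis
    using * cop[OF assms(2)] cop[OF assms(3)] zero_in_padic_ideal[OF assms(1), of m]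
    unfolding rat_cong_def by (cases "x = y") auto
qed

text \<open>Multiplying by the reduced denominator of \<open>y\<close>, which is prime to
  \<open>p\<close>, turns the claim into divisibility of an integer product by a prime.\<close>

lemma padic_ideal_1_mult_iff:
  assumes "prime p" "y \<in> padic_ideal p 0"
  shows "of_int a * y \<in> padic_ideal p 1 \<longleftrightarrow> int p dvd a \<or> int p dvd rat_numerator y"
proof -
  have p: "prime (int p)" using assms by simp
  have y: "\<not> int p dvd rat_denominator y" using assms by (simp add: padic_ideal_iff)
  have "of_int a * y = of_int (a * rat_numerator y) / of_int (rat_denominator y)"
    by (subst rat_eq_numerator_divide_denominator[of y]) simp
  then have eq: "of_int (a * rat_numerator y) = of_int (rat_denominator y) * (of_int a * y)"
    using rat_denominator_pos[of y] by simp
  have "of_int a * y \<in> padic_ideal p 1 \<longleftrightarrow> (of_int (a * rat_numerator y) :: rat) \<in> padic_ideal p 1"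
    unfolding eq using padic_ideal_unit_mult_iff[OF assms(1) y] by simp
  also have "\<dots> \<longleftrightarrow> int p dvd a * rat_numerator y"
    using assms(1) of_int_in_padic_ideal[of p 1 "a * rat_numerator y"]
    by (auto simp: padic_ideal_iff rat_numerator_def rat_denominator_def simp del: of_int_mult)
  finally show ?thesis using p by (simp add: prime_dvd_mult_iff)
qed

subsection \<open>Generating polynomial of the harmonic sums\<close>

text \<open>A decreasing list with entries at most \<open>Suc m\<close> either starts with
  \<open>Suc m\<close> or has all its entries at most \<open>m\<close>.\<close>

lemma elem_harmonic_Suc_Suc:
  "elem_harmonic (Suc j) (Suc m) = elem_harmonic (Suc j) m + elem_harmonic j m / of_nat (Suc m)"
proof -
  let ?S = "\<lambda>j m. {is. length is = j \<and> sorted_wrt (>) is \<and> set is \<subseteq> {1..m::nat}}"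
  have eq: "?S (Suc j) (Suc m) = ?S (Suc j) m \<union> (#) (Suc m) ` ?S j m"
  proof (intro equalityI subsetI)
    fix xs assume xs: "xs \<in> ?S (Suc j) (Suc m)"
    then obtain y ys where [simp]: "xs = y # ys" by (cases xs) auto
    have ys: "\<forall>z\<in>set ys. z < y \<and> 1 \<le> z" and y: "1 \<le> y" "y \<le> Suc m"
      using xs by auto
    show "xs \<in> ?S (Suc j) m \<union> (#) (Suc m) ` ?S j m"
    proof (cases "y = Suc m")
      case True
      then have "set ys \<subseteq> {1..m}" using ys by (auto simp: less_Suc_eq_le)
      then show ?thesis using xs True by auto
    next
      case False
      then have "set xs \<subseteq> {1..m}" using ys y by (auto dest: bspec)
      then show ?thesis using xs by auto
    qed
  qed (auto simp: subset_iff less_Suc_eq_le)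
  have "elem_harmonic (Suc j) (Suc m) =
      elem_harmonic (Suc j) m + (\<Sum>is\<in>(#) (Suc m) ` ?S j m. \<Prod>i\<leftarrow>is. 1 / of_nat i)"
    unfolding elem_harmonic_def eq
    by (rule sum.union_disjoint[OF finite_elem_harmonic_index
          finite_imageI[OF finite_elem_harmonic_index]]) auto
  also have "(\<Sum>is\<in>(#) (Suc m) ` ?S j m. \<Prod>i\<leftarrow>is. 1 / of_nat i) = elem_harmonic j m / of_nat (Suc m)"
    unfolding elem_harmonic_def
    by (subst sum.reindex) (auto simp: sum_divide_distrib)
  finally show ?thesis .
qed

text \<open>This is the product of the factors 1 + x/i for i from 1 to \<open>m\<close>. The
  expanded form makes its coefficients available by definition.\<close>

definition harmonic_poly :: "nat \<Rightarrow> rat poly" where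
  "harmonic_poly m = (\<Sum>j\<le>m. monom (elem_harmonic j m) j)"

lemma coeff_harmonic_poly: "coeff (harmonic_poly m) j = elem_harmonic j m"
  by (simp add: harmonic_poly_def coeff_sum elem_harmonic_eq_0)

lemma harmonic_poly_Suc: "harmonic_poly (Suc m) = [:1, 1 / of_nat (Suc m):] * harmonic_poly m"
proof (rule poly_eqI)
  fix i
  show "coeff (harmonic_poly (Suc m)) i = coeff ([:1, 1 / of_nat (Suc m):] * harmonic_poly m) i"
    by (cases i) (simp_all add: coeff_harmonic_poly elem_harmonic_Suc_Suc)
qed

lemma harmonic_poly_0: "harmonic_poly 0 = 1"
  by (simp add: harmonic_poly_def)

lemma poly_harmonic_poly: "poly (harmonic_poly m) x = (\<Prod>i=1..m. 1 + x / of_nat i)"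
  by (induction m) (simp_all add: harmonic_poly_0 harmonic_poly_Suc field_simps)

lemma elem_harmonic_diag: "elem_harmonic m m = 1 / fact m"
  by (induction m) (simp_all add: elem_harmonic_Suc_Suc elem_harmonic_eq_0)

lemma poly_harmonic_poly_sum: "poly (harmonic_poly m) x = (\<Sum>j\<le>m. elem_harmonic j m * x ^ j)"
  by (simp add: harmonic_poly_def poly_sum poly_monom)

text \<open>Write h for \<open>harmonic_poly m\<close>. The product telescopes under x to x + 1, so
  (x + 1) h(x + 1) = (x + 1 + m) h(x). The claim compares the coefficients of x^s.\<close>

lemma coeff_harmonic_poly_shift:
  "(\<Sum>j\<le>m. of_nat (Suc j choose s) * elem_harmonic j m) =
     of_nat (Suc m) * elem_harmonic s m + (if s = 0 then 0 else elem_harmonic (s - 1) m)"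
proof -
  let ?h = "harmonic_poly m"
  define G where "G = (\<Sum>j\<le>m. smult (elem_harmonic j m) ([:1, 1:] ^ Suc j))"
  \<comment> \<open>Multiplied by \<open>fact m\<close>, both sides are the product of x + 1, ..., x
    + m + 1.\<close>
  have shift: "(\<Prod>i=1..m. 1 + (x + 1) / of_nat i) * (x + 1) =
      (\<Prod>i=1..m. 1 + x / of_nat i) * (x + 1 + of_nat m)" for x :: rat
    by (induction m) (simp_all add: field_simps)
  have eq: "G = smult (of_nat (Suc m)) ?h + pCons 0 ?h"
  proof (rule poly_eq_poly_eq_iff[THEN iffD1], rule ext)
    fix x
    have "poly G x = (x + 1) * poly ?h (x + 1)"
      unfolding G_def poly_harmonic_poly_sum by (simp add: poly_sum sum_distrib_left algebra_simps)
    also have "\<dots> = (x + 1 + of_nat m) * poly ?h x"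
      using shift[of x] by (simp add: poly_harmonic_poly mult.commute)
    finally show "poly G x = poly (smult (of_nat (Suc m)) ?h + pCons 0 ?h) x"
      by (simp add: algebra_simps)
  qed
  have "coeff ([:1, 1:] ^ i) s = (of_nat (i choose s) :: rat)" for i
  proof (induction i arbitrary: s)
    case (Suc i)
    then show ?case by (cases s) simp_all
  qed simp
  then show ?thesis
    using arg_cong[OF eq, of "\<lambda>q. coeff q s"]
    unfolding G_def
    by (cases s) (simp_all add: coeff_sum coeff_harmonic_poly mult.commute
        del: power_Suc binomial_Suc_Suc)
qed

text \<open>This is the coefficient identity at s = m - r, read from the top index downwards. The
  term j = s - 1 cancels the lower harmonic sum on the right, and the term j = s leaves the factor
  (m + 1) - (s + 1) = r.\<close>

lemma elem_harmonic_recursion: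
  assumes "r \<le> m"
  shows "(\<Sum>i<r. of_nat (Suc m - i choose (m - r)) * elem_harmonic (m - i) m) =
    of_nat r * elem_harmonic (m - r) m"
proof -
  let ?s = "m - r" and ?H = "\<lambda>j. elem_harmonic j m"
  let ?f = "\<lambda>j. of_nat (Suc j choose ?s) * ?H j"
  have "(\<Sum>j\<le>m. ?f j) = (\<Sum>j<?s. ?f j) + (\<Sum>j\<in>{?s..m}. ?f j)"
    by (subst sum.union_disjoint [symmetric]) (auto intro!: sum.cong)
  also have "(\<Sum>j<?s. ?f j) = (if ?s = 0 then 0 else ?H (?s - 1))"
  proof (cases ?s)
    case (Suc t)
    show ?thesis unfolding Suc
      by (simp add: lessThan_Suc binomial_eq_0 del: binomial_Suc_Suc)
  qed auto
  finally have 1: "(\<Sum>j\<in>{?s..m}. ?f j) = of_nat (Suc m) * ?H ?s"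
    using coeff_harmonic_poly_shift[where s = ?s and m = m] by simp
  have "(\<Sum>j\<in>{?s..m}. ?f j) = (\<Sum>i\<le>r. ?f (m - i))"
    by (rule sum.reindex_bij_witness[of _ "\<lambda>i. m - i" "\<lambda>j. m - j"]) (use assms in auto)
  also have "\<dots> = (\<Sum>i<r. ?f (m - i)) + of_nat (Suc ?s) * ?H ?s"
    by (simp add: lessThan_Suc_atMost [symmetric])
  finally have "(\<Sum>i<r. ?f (m - i)) = of_nat r * ?H ?s"
    using 1 assms by (simp add: algebra_simps of_nat_diff)
  moreover have "(\<Sum>i<r. ?f (m - i)) = (\<Sum>i<r. of_nat (Suc m - i choose (m - r)) * ?H (m - i))"
    using assms by (intro sum.cong) (simp_all add: Suc_diff_le)
  ultimately show ?thesis by simp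
qed

subsection \<open>Harmonic sums and Bernoulli numbers\<close>

text \<open>Compare the coefficients of t^(r+1) in
  \<open>bernoulli_fps * (fps_exp 1 - 1) = fps_X\<close> and multiply by (r + 1)!.\<close>

lemma bernoulli_number_recursion:
  "(\<Sum>i\<le>r. of_nat (Suc r choose i) * bernoulli_number i) = (if r = 0 then 1 else 0)"
proof -
  have "(\<Sum>i\<le>Suc r. fps_nth bernoulli_fps i * fps_nth (fps_exp 1 - 1) (Suc r - i)) =
      fps_nth fps_X (Suc r)"
    using arg_cong[OF bernoulli_fps_mult, of "\<lambda>f. fps_nth f (Suc r)"]
    by (simp add: fps_mult_nth atLeast0AtMost)
  moreover have "(\<Sum>i\<le>r. fps_nth bernoulli_fps i * fps_nth (fps_exp 1 - 1) (Suc r - i)) =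
      (\<Sum>i\<le>r. fps_nth bernoulli_fps i / fact (Suc r - i))"
    by (intro sum.cong) simp_all
  ultimately have "(\<Sum>i\<le>r. fps_nth bernoulli_fps i / fact (Suc r - i)) = (if r = 0 then 1 else 0)"
    by (simp add: Suc_diff_le del: fact_Suc)
  then have "fact (Suc r) * (\<Sum>i\<le>r. fps_nth bernoulli_fps i / fact (Suc r - i)) =
      (if r = 0 then 1 else 0)"
    by simp
  moreover have "fact (Suc r) * (\<Sum>i\<le>r. fps_nth bernoulli_fps i / fact (Suc r - i)) =
      (\<Sum>i\<le>r. of_nat (Suc r choose i) * bernoulli_number i)"
    unfolding sum_distrib_left bernoulli_number_def
    by (intro sum.cong) (simp_all add: binomial_fact del: binomial_Suc_Suc fact_Suc)
  ultimately show ?thesis by simp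
qed

lemma bernoulli_number_0: "bernoulli_number 0 = 1"
  using bernoulli_number_recursion[of 0] by simp

lemma not_dvd_int_if_less: "0 < c \<Longrightarrow> c < p \<Longrightarrow> \<not> int p dvd int c"
  by (simp add: nat_dvd_not_less)

lemma not_prime_dvd_fact: "prime p \<Longrightarrow> m < p \<Longrightarrow> \<not> int p dvd fact m"
  using prime_dvd_fact_iff[of p m] by (metis int_dvd_int_iff not_less of_nat_fact)

text \<open>The recursion expresses (r + 1) B_r through earlier Bernoulli numbers with integer
  coefficients, and r + 1 < p is a unit.\<close>

lemma bernoulli_number_in_padic_ideal_0:
  assumes "prime p"
  shows "r + 2 \<le> p \<Longrightarrow> bernoulli_number r \<in> padic_ideal p 0"
proof (induction r rule: less_induct)
  case (less r)
  have "(\<Sum>i\<le>r. of_nat (Suc r choose i) * bernoulli_number i) =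
      (\<Sum>i<r. of_nat (Suc r choose i) * bernoulli_number i) + of_nat (Suc r) * bernoulli_number r"
    by (simp add: lessThan_Suc_atMost [symmetric] del: binomial_Suc_Suc)
  then have "of_int (int (Suc r)) * bernoulli_number r =
      of_nat (if r = 0 then 1 else 0) - (\<Sum>i<r. of_nat (Suc r choose i) * bernoulli_number i)"
    using bernoulli_number_recursion[of r] by (cases "r = 0") simp_all
  also have "\<dots> \<in> padic_ideal p 0"
    using less assms
    by (intro padic_ideal_diff padic_ideal_sum padic_ideal_mult_left of_nat_in_padic_ideal_0) auto
  finally show ?case
    using assms less.prems not_dvd_int_if_less[of "Suc r" p] padic_ideal_unit_mult_iff
    by (metis Suc_le_eq add_2_eq_Suc' zero_less_Suc)
qed

section \<open>Binomial coefficients modulo a prime\<close>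

text \<open>The numerator is a polynomial in \<open>x\<close> with integer coefficients, and the
  denominator \<open>fact m\<close> is prime to \<open>p\<close>.\<close>

lemma gbinomial_cong_prime:
  assumes "prime p" "m < p" "x \<in> padic_ideal p 0" "y \<in> padic_ideal p 0" "x - y \<in> padic_ideal p 1"
  shows "(x gchoose m) - (y gchoose m) \<in> padic_ideal p 1"
proof -
  have int: "(\<Prod>i=0..<m. z - of_nat i) \<in> padic_ideal p 0" if "z \<in> padic_ideal p 0" for z and m :: nat
    using that assms(1) of_nat_in_padic_ideal_0[of p 1]
    by (induction m)
       (auto intro!: padic_ideal_mult_left padic_ideal_diff of_nat_in_padic_ideal_0)
  have "(\<Prod>i=0..<m. x - of_nat i) - (\<Prod>i=0..<m. y - of_nat i) \<in> padic_ideal p 1"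
  proof (induction m)
    case 0
    then show ?case using assms(1) by (simp add: zero_in_padic_ideal)
  next
    case (Suc m)
    let ?P = "\<lambda>z. \<Prod>i=0..<m. z - of_nat i"
    have "?P x * (x - of_nat m) - ?P y * (y - of_nat m) =
        ?P x * (x - y) + (?P x - ?P y) * (y - of_nat m)"
      by (simp add: algebra_simps)
    also have "\<dots> \<in> padic_ideal p 1"
      using assms int Suc padic_ideal_diff[OF assms(1,4) of_nat_in_padic_ideal_0[OF assms(1)]]
      by (intro padic_ideal_add padic_ideal_mult_left padic_ideal_mult_right)
    finally show ?case by simp
  qed
  then have "((\<Prod>i=0..<m. x - of_nat i) - (\<Prod>i=0..<m. y - of_nat i)) / of_int (fact m) \<in> padic_ideal p 1"
    using assms by (intro padic_ideal_divide_unit not_prime_dvd_fact)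
  then show ?thesis by (simp add: gbinomial_prod_rev diff_divide_distrib)
qed

text \<open>Since p - i is congruent to -i, the coefficient may be replaced by the generalized one
  at -i, to which negation of the upper index applies.\<close>

lemma choose_prime_minus_cong:
  assumes "prime p" "m < p" "0 < i" "i \<le> p"
  shows "of_nat (p - i choose m) - (-1) ^ m * of_nat (i + m - 1 choose m) \<in> padic_ideal p 1"
proof -
  have "of_nat (p - i) - (- of_nat i) \<in> padic_ideal p 1"
    using assms prime_power_in_padic_ideal[of p 1] by (simp add: of_nat_diff)
  then have "(of_nat (p - i) gchoose m) - (- of_nat i gchoose m) \<in> padic_ideal p 1"
    using assms by (intro gbinomial_cong_prime padic_ideal_uminus of_nat_in_padic_ideal_0)
  moreover have "(- of_nat i gchoose m :: rat) = (-1) ^ m * of_nat (i + m - 1 choose m)"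
    using assms(3) by (simp add: gbinomial_minus binomial_gbinomial of_nat_diff)
  ultimately show ?thesis by (simp add: binomial_gbinomial)
qed

text \<open>This is the \<open>r\<close>-th elementary symmetric function of \<open>1, \<dots>, p - 1\<close>, provided that \<open>r < p\<close>
  (the subtraction truncates).\<close>

definition scaled_harmonic :: "nat \<Rightarrow> nat \<Rightarrow> rat" where
  "scaled_harmonic p r = fact (p - 1) * elem_harmonic (p - 1 - r) (p - 1)"

text \<open>The recursion of the harmonic sums for m = p - 1, with each binomial coefficient
  replaced by its mirror image so that the lower index is small.\<close>

lemma scaled_harmonic_recursion:
  assumes "r < p"
  shows "of_nat r * scaled_harmonic p r =
    (\<Sum>i<r. of_nat (p - i choose (r + 1 - i)) * scaled_harmonic p i)"
proof -
  have "of_nat r * scaled_harmonic p r =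
      fact (p - 1) * (\<Sum>i<r. of_nat (Suc (p - 1) - i choose (p - 1 - r)) * elem_harmonic (p - 1 - i) (p - 1))"
    using assms elem_harmonic_recursion[of r "p - 1"] by (simp add: scaled_harmonic_def)
  also have "\<dots> = (\<Sum>i<r. of_nat (p - i choose (r + 1 - i)) * scaled_harmonic p i)"
    unfolding sum_distrib_left
  proof (rule sum.cong)
    fix i assume "i \<in> {..<r}"
    then have "Suc (p - 1) - i choose (p - 1 - r) = (p - i choose (r + 1 - i))"
      using assms binomial_symmetric[of "p - 1 - r" "p - i"] by (simp add: Suc_diff_le)
    then show "fact (p - 1) * (of_nat (Suc (p - 1) - i choose (p - 1 - r)) * elem_harmonic (p - 1 - i) (p - 1)) =
        of_nat (p - i choose (r + 1 - i)) * scaled_harmonic p i"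
      by (simp add: scaled_harmonic_def)
  qed simp
  finally show ?thesis .
qed

lemma scaled_harmonic_0: "scaled_harmonic p 0 = 1"
  by (simp add: scaled_harmonic_def elem_harmonic_diag)

text \<open>Modulo \<open>p\<close> the Bernoulli term vanishes, because B_i is
  \<open>p\<close>-integral, and the factor \<open>i\<close> is a unit.\<close>

lemma scaled_harmonic_in_padic_ideal_1:
  assumes p: "prime p" and i: "0 < i" "i + 2 \<le> p"
    and D: "of_nat i * scaled_harmonic p i + (-1) ^ i * of_nat p * bernoulli_number i \<in> padic_ideal p 2"
      (is "?D \<in> _")
  shows "scaled_harmonic p i \<in> padic_ideal p 1"
proof -
  have pB: "of_nat p * bernoulli_number i \<in> padic_ideal p 1"
    using bernoulli_number_in_padic_ideal_0[OF p i(2)] prime_power_in_padic_ideal[OF p, of 1]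
    by (intro padic_ideal_mult_right p) auto
  have "?D - (-1) ^ i * (of_nat p * bernoulli_number i) \<in> padic_ideal p 1"
    using padic_ideal_mono[OF p D, of 1] of_int_in_padic_ideal_0[OF p, of "(-1) ^ i"]
    by (intro padic_ideal_diff padic_ideal_mult_left[OF p _ pB] p) auto
  then have "of_int (int i) * scaled_harmonic p i \<in> padic_ideal p 1" by (simp add: algebra_simps)
  then show ?thesis
    using padic_ideal_unit_mult_iff[OF p not_dvd_int_if_less[OF i(1)]] i(2) by simp
qed

text \<open>Matches the summands of the two recursions one by one. A congruence of binomial
  coefficients modulo \<open>p\<close> suffices modulo \<open>p^2\<close>, because a further factor
  \<open>p\<close> comes from the scaled sum if i > 0 and from the binomial coefficient if i =
  0.\<close>

lemma scaled_harmonic_term_cong: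
  assumes p: "prime p" and "i < r" "r + 2 \<le> p"
    and i: "0 < i \<Longrightarrow> of_nat i * scaled_harmonic p i + (-1) ^ i * of_nat p * bernoulli_number i \<in> padic_ideal p 2"
  shows "of_nat (r + 1) * (of_nat (p - i choose (r + 1 - i)) * scaled_harmonic p i) -
    (-1) ^ r * of_nat p * of_nat (r + 1 choose i) * bernoulli_number i \<in> padic_ideal p 2"
proof (cases "i = 0")
  case True
  \<comment> \<open>Absorption extracts the factor \<open>p\<close>; what remains is a congruence
    modulo \<open>p\<close> only.\<close>
  have "(r + 1) * (p choose (r + 1)) = p * (p - 1 choose r)"
    using times_binomial_minus1_eq[of "r + 1" p] by simp
  then have "of_nat (r + 1) * of_nat (p choose (r + 1)) = (of_nat p * of_nat (p - 1 choose r) :: rat)"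
    by (simp only: flip: of_nat_mult)
  then have "of_nat (r + 1) * of_nat (p choose (r + 1)) - (-1) ^ r * of_nat p =
      of_nat p * (of_nat (p - 1 choose r) - (-1) ^ r * of_nat (1 + r - 1 choose r) :: rat)"
    by (simp add: algebra_simps)
  also have "\<dots> \<in> padic_ideal p (Suc 1)"
    unfolding padic_ideal_prime_mult_iff[OF p]
    using assms by (intro choose_prime_minus_cong) auto
  finally show ?thesis using True by (simp add: scaled_harmonic_0 bernoulli_number_0 numeral_2_eq_2)
next
  case False
  define c where "c = r + 1 - i"
  let ?u = "scaled_harmonic p i" and ?B = "bernoulli_number i"
  let ?D = "of_nat i * ?u + (-1) ^ i * of_nat p * ?B"
  let ?E = "of_nat (p - i choose c) - (-1) ^ c * of_nat (r choose c) :: rat"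
  have i0: "0 < i" using False by simp
  have D: "?D \<in> padic_ideal p 2" using i[OF i0] .
  have u: "?u \<in> padic_ideal p 1"
    using assms(2,3) by (intro scaled_harmonic_in_padic_ideal_1 p i0 D) simp
  have E: "?E \<in> padic_ideal p 1"
    using choose_prime_minus_cong[OF p, of c i] assms(2,3) i0 by (simp add: c_def)
  \<comment> \<open>Since c = r + 1 - i, the coefficient r choose c equals r choose (i - 1), and
    absorption applies. The factor \<open>i\<close> completes the combination \<open>?D\<close> of
    the hypothesis.\<close>
  have "(r + 1) * (r choose c) = i * (r + 1 choose i)"
    using times_binomial_minus1_eq[OF i0, of "r + 1"] binomial_symmetric[of "i - 1" r] assms(2) i0
    by (simp add: c_def del: binomial_Suc_Suc)
  then have b: "of_nat (r + 1) * of_nat (r choose c) = (of_nat i * of_nat (r + 1 choose i) :: rat)"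
    by (simp only: flip: of_nat_mult)
  have sgn: "(-1) ^ c * (-1) ^ i = (- ((-1) ^ r) :: rat)"
    using assms(2) by (simp add: c_def flip: power_add)
  have "of_nat (r + 1) * (of_nat (p - i choose c) * ?u) -
      (-1) ^ r * of_nat p * of_nat (r + 1 choose i) * ?B =
    of_nat (r + 1) * (?E * ?u) + (-1) ^ c * ((of_nat (r + 1) * of_nat (r choose c)) * ?u) +
      ((-1) ^ c * (-1) ^ i) * of_nat p * of_nat (r + 1 choose i) * ?B"
    unfolding sgn by (simp add: algebra_simps del: binomial_Suc_Suc of_nat_add)
  also have "\<dots> = of_nat (r + 1) * (?E * ?u) + (-1) ^ c * of_nat (r + 1 choose i) * ?D"
    unfolding b by (simp add: algebra_simps del: binomial_Suc_Suc)
  also have "\<dots> \<in> padic_ideal p 2"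
    using padic_ideal_mult[OF p E u] D of_int_in_padic_ideal_0[OF p, of "(-1) ^ c"]
    by (intro padic_ideal_add padic_ideal_mult_left[OF p of_nat_in_padic_ideal_0]
        padic_ideal_mult_left[OF p _ D] padic_ideal_mult_left[OF p _ of_nat_in_padic_ideal_0] p)
       (auto simp: numeral_2_eq_2)
  finally show ?thesis by (simp only: c_def)
qed

text \<open>Summing the termwise congruences gives (r + 1) times the claim: the left sum is r u_r by
  its recursion, the right one is -(r + 1) B_r by the Bernoulli recursion. Finally r + 1 < p is a
  unit.\<close>

lemma scaled_harmonic_cong:
  assumes p: "prime p"
  shows "0 < r \<Longrightarrow> r + 2 \<le> p \<Longrightarrow>
    of_nat r * scaled_harmonic p r + (-1) ^ r * of_nat p * bernoulli_number r \<in> padic_ideal p 2"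
proof (induction r rule: less_induct)
  case (less r)
  let ?T = "\<lambda>i. of_nat (p - i choose (r + 1 - i)) * scaled_harmonic p i"
  let ?B = "\<lambda>i. of_nat (r + 1 choose i) * bernoulli_number i"
  have "(\<Sum>i<r. of_nat (r + 1) * ?T i - (-1) ^ r * of_nat p * ?B i) \<in> padic_ideal p 2"
    unfolding mult.assoc[symmetric] using less
    by (intro padic_ideal_sum p scaled_harmonic_term_cong[OF p, unfolded mult.assoc[symmetric]]) auto
  also have "(\<Sum>i<r. of_nat (r + 1) * ?T i - (-1) ^ r * of_nat p * ?B i) =
      of_nat (r + 1) * (\<Sum>i<r. ?T i) - (-1) ^ r * of_nat p * (\<Sum>i<r. ?B i)"
    by (simp only: sum_subtractf sum_distrib_left)
  also have "(\<Sum>i<r. ?T i) = of_nat r * scaled_harmonic p r"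
    using less.prems by (simp only: scaled_harmonic_recursion)
  also have "(\<Sum>i<r. ?B i) = - of_nat (r + 1) * bernoulli_number r"
    using bernoulli_number_recursion[of r] less.prems(1)
    by (simp add: lessThan_Suc_atMost [symmetric] algebra_simps del: binomial_Suc_Suc)
  finally have "of_int (int (r + 1)) *
      (of_nat r * scaled_harmonic p r + (-1) ^ r * of_nat p * bernoulli_number r) \<in> padic_ideal p 2"
    by (simp add: algebra_simps)
  then show ?case
    using padic_ideal_unit_mult_iff[OF p not_dvd_int_if_less[of "r + 1" p]] less.prems by simp
qed

lemma elem_harmonic_in_padic_ideal_0:
  assumes "prime p"
  shows "m < p \<Longrightarrow> elem_harmonic j m \<in> padic_ideal p 0"
proof (induction m arbitrary: j)
  case 0
  then show ?case
    using assms of_int_in_padic_ideal_0[of p 1]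
    by (cases j) (auto simp: elem_harmonic_eq_0 zero_in_padic_ideal)
next
  case (Suc m)
  show ?case
  proof (cases j)
    case 0
    then show ?thesis using assms of_int_in_padic_ideal_0[of p 1] by simp
  next
    case (Suc i)
    have "elem_harmonic i m / of_int (int (Suc m)) \<in> padic_ideal p 0"
      using Suc.prems Suc.IH assms by (intro padic_ideal_divide_unit not_dvd_int_if_less) auto
    then show ?thesis
      using Suc.prems Suc.IH[of "Suc i"] assms unfolding Suc elem_harmonic_Suc_Suc
      by (intro padic_ideal_add) auto
  qed
qed

subsection \<open>Extremal polynomials\<close>

text \<open>Division by a monic polynomial from the top: the coefficient of the product at degree M
  + i is the i-th coefficient of \<open>Q\<close> plus a combination of higher coefficients of
  \<open>Q\<close>. Hence the induction descends, and only product coefficients from degree M on are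
  involved.\<close>

lemma monic_multiple_coeff_in_padic_ideal:
  assumes p: "prime p" and "lead_coeff M = 1" "\<And>i. coeff M i \<in> padic_ideal p 0"
    and MQ: "\<And>i. degree M \<le> i \<Longrightarrow> coeff (M * Q) i \<in> padic_ideal p m"
  shows "coeff Q i \<in> padic_ideal p m"
proof (induction "Suc (degree Q) - i" arbitrary: i rule: less_induct)
  case less
  show ?case
  proof (cases "i \<le> degree Q")
    case False
    then show ?thesis using p by (simp add: coeff_eq_0 zero_in_padic_ideal)
  next
    case True
    let ?d = "degree M"
    have "coeff (M * Q) (?d + i) = (\<Sum>l\<le>?d + i. coeff M l * coeff Q (?d + i - l))"
      by (rule coeff_mult)
    also have "\<dots> = (\<Sum>l\<le>?d. coeff M l * coeff Q (?d + i - l))"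
      by (rule sum.mono_neutral_right) (auto simp: coeff_eq_0)
    also have "\<dots> = (\<Sum>l<?d. coeff M l * coeff Q (?d + i - l)) + coeff Q i"
      using assms(2) by (simp add: lessThan_Suc_atMost [symmetric])
    finally have "coeff Q i = coeff (M * Q) (?d + i) - (\<Sum>l<?d. coeff M l * coeff Q (?d + i - l))"
      by simp
    also have "\<dots> \<in> padic_ideal p m"
      using assms(3) less True
      by (intro padic_ideal_diff padic_ideal_sum padic_ideal_mult_left p MQ) auto
    finally show ?thesis .
  qed
qed

lemma poly_in_padic_ideal:
  assumes "prime p" "\<And>i. coeff Q i \<in> padic_ideal p m"
  shows "poly Q (of_int k) \<in> padic_ideal p m"
  unfolding poly_altdef
  using assms
  by (intro padic_ideal_sum padic_ideal_mult_right padic_ideal_power_0 of_int_in_padic_ideal_0) auto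

lemma coeff_power_in_padic_ideal_0:
  assumes p: "prime p" and q: "\<And>i. coeff q i \<in> padic_ideal p 0"
  shows "coeff (q ^ n) i \<in> padic_ideal p 0"
proof (induction n arbitrary: i)
  case 0
  then show ?case
    using zero_in_padic_ideal[OF p] of_int_in_padic_ideal_0[OF p, of 1] by simp
next
  case (Suc n)
  then show ?case
    unfolding power_Suc coeff_mult by (intro padic_ideal_sum padic_ideal_mult_left p q)
qed

section \<open>The interpolation remainder\<close>

text \<open>Replacing i by p - i turns i - px into -(i + p(x - 1)). There are p - 1 such factors, an
  even number, so the signs cancel.\<close>

lemma poly_harmonic_poly_reflect:
  assumes "odd p"
  shows "poly (harmonic_poly (p - 1)) (- of_nat p * x) =
    poly (harmonic_poly (p - 1)) (of_nat p * (x - 1))"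
proof -
  have fact: "poly (harmonic_poly (p - 1)) y = (\<Prod>i=1..p-1. of_nat i + y) / fact (p - 1)" for y
    by (simp add: poly_harmonic_poly fact_prod flip: prod_dividef)
       (intro prod.cong, auto simp: field_simps)
  have "(\<Prod>i=1..p-1. of_nat i + - of_nat p * x) = (\<Prod>i=1..p-1. of_nat (p - i) + - of_nat p * x)"
    by (rule prod.reindex_bij_witness[of _ "\<lambda>i. p - i" "\<lambda>i. p - i"]) auto
  also have "\<dots> = (\<Prod>i=1..p-1. (-1) * (of_nat i + of_nat p * (x - 1)))"
    by (intro prod.cong) (auto simp: of_nat_diff algebra_simps)
  also have "\<dots> = (\<Prod>i=1..p-1. of_nat i + of_nat p * (x - 1))"
    using assms by (subst prod.distrib) simp
  finally show ?thesis unfolding fact by simp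
qed

text \<open>The numerator is the product of kp - i for 0 < i < p; an even number of signs is
  extracted and (p - 1)! is cancelled.\<close>

lemma gbinomial_eq_poly_harmonic_poly:
  assumes "odd p"
  shows "(of_int (k * int p - 1) gchoose (p - 1)) =
    poly (harmonic_poly (p - 1)) (- of_nat p * of_int k)"
proof -
  have "(of_int (k * int p - 1) gchoose (p - 1)) =
      (\<Prod>i=0..<p-1. of_int (k * int p - 1) - of_nat i) / (fact (p - 1) :: rat)"
    by (simp add: gbinomial_prod_rev)
  also have "(\<Prod>i=0..<p-1. of_int (k * int p - 1) - of_nat i) =
      (\<Prod>i=1..p-1. of_nat p * of_int k - of_nat i :: rat)"
    by (rule prod.reindex_bij_witness[of _ "\<lambda>i. i - 1" "\<lambda>i. i + 1"]) (auto simp: of_nat_diff)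
  also have "\<dots> = (\<Prod>i=1..p-1. (-1) * (of_nat i * (1 + (- of_nat p * of_int k) / of_nat i)))"
    by (intro prod.cong) (auto simp: field_simps)
  also have "\<dots> = fact (p - 1) * poly (harmonic_poly (p - 1)) (- of_nat p * of_int k)"
    unfolding prod.distrib using assms by (simp add: poly_harmonic_poly fact_prod)
  finally show ?thesis by simp
qed

text \<open>Used with \<open>D\<close> a power of T or of T - 1: the terms up to \<open>n\<close>
  agree modulo \<open>D\<close>, and the later ones are divisible by it.\<close>

lemma dvd_sum_smult_diff:
  fixes g b :: "nat \<Rightarrow> rat poly"
  assumes "n \<le> m" "\<And>j. j \<le> n \<Longrightarrow> [b j = g j] (mod D)" "\<And>j. n < j \<Longrightarrow> D dvd g j"
  shows "D dvd (\<Sum>j\<le>m. smult (c j) (g j)) - (\<Sum>j=0..n. smult (c j) (b j))"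
proof -
  have "(\<Sum>j\<le>m. smult (c j) (g j)) =
      (\<Sum>j=0..n. smult (c j) (g j)) + (\<Sum>j\<in>{n<..m}. smult (c j) (g j))"
    using assms(1) by (subst sum.union_disjoint [symmetric]) (auto intro!: sum.cong)
  then have "(\<Sum>j\<le>m. smult (c j) (g j)) - (\<Sum>j=0..n. smult (c j) (b j)) =
      (\<Sum>j=0..n. smult (c j) (g j - b j)) + (\<Sum>j\<in>{n<..m}. smult (c j) (g j))"
    by (simp add: smult_diff_right sum_subtractf)
  also have "D dvd \<dots>"
    using assms(2,3)
    by (intro dvd_add dvd_sum dvd_smult)
       (auto simp: cong_iff_dvd_diff dvd_diff_commute)
  finally show ?thesis .
qed

text \<open>The same polynomial is expanded once in powers of T and once in powers of T - 1, with
  coefficients equal up to sign. The two congruences that define the extremal polynomials match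
  these expansions, and the two moduli are coprime.\<close>

lemma extremal_remainder_dvd:
  assumes "odd p" "n < p"
  shows "([:0, 1:] * [:-1, 1:]) ^ (n + 1) dvd
    (\<Sum>j\<le>p-1. monom ((- of_nat p) ^ j * elem_harmonic j (p - 1)) j) -
    (\<Sum>j=0..n. smult (of_nat p ^ j * elem_harmonic j (p - 1)) (extremal_poly j n))"
    (is "_ dvd ?F - ?E")
proof -
  let ?X = "[:0, 1:] :: rat poly" and ?Y = "[:-1, 1:] :: rat poly"
  let ?c = "\<lambda>j. of_nat p ^ j * elem_harmonic j (p - 1) :: rat"
  have F1: "?F = (\<Sum>j\<le>p-1. smult (?c j) ((-1) ^ j * ?X ^ j))"
  proof (rule sum.cong)
    fix j
    have "(-1) ^ j * ?X ^ j = monom ((-1) ^ j) j"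
      by (simp add: monom_altdef power_minus [of "1 :: rat poly"] uminus_power_if)
    then show "monom ((- of_nat p) ^ j * elem_harmonic j (p - 1)) j = smult (?c j) ((-1) ^ j * ?X ^ j)"
      by (simp add: smult_monom power_minus[of "of_nat p"] mult_ac)
  qed simp
  have F2: "?F = (\<Sum>j\<le>p-1. smult (?c j) (?Y ^ j))"
  proof (rule poly_eq_poly_eq_iff[THEN iffD1], rule ext)
    fix x
    have "poly ?F x = poly (harmonic_poly (p - 1)) (- of_nat p * x)"
      unfolding poly_harmonic_poly_sum power_mult_distrib by (simp add: poly_sum poly_monom mult_ac)
    also have "\<dots> = poly (harmonic_poly (p - 1)) (of_nat p * (x - 1))"
      by (rule poly_harmonic_poly_reflect[OF assms(1)])
    also have "\<dots> = poly (\<Sum>j\<le>p-1. smult (?c j) (?Y ^ j)) x"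
      unfolding poly_harmonic_poly_sum power_mult_distrib by (simp add: poly_sum mult_ac)
    finally show "poly ?F x = poly (\<Sum>j\<le>p-1. smult (?c j) (?Y ^ j)) x" .
  qed
  have "n \<le> p - 1" using assms(2) by simp
  note dvd_F = dvd_sum_smult_diff[OF this, where c = ?c and b = "\<lambda>j. extremal_poly j n"]
  have "?X ^ (n + 1) dvd ?F - ?E"
    unfolding F1
    using is_extremal_poly_extremal_poly[unfolded is_extremal_poly_def]
    by (intro dvd_F dvd_mult le_imp_power_dvd) auto
  moreover have "?Y ^ (n + 1) dvd ?F - ?E"
    unfolding F2
    using is_extremal_poly_extremal_poly[unfolded is_extremal_poly_def]
    by (intro dvd_F le_imp_power_dvd) auto
  moreover obtain u v where "v * ?Y ^ (n + 1) + u * ?X ^ (n + 1) = 1"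
  proof -
    have "1 * ?X + (-1) * ?Y = 1" by (simp add: one_pCons)
    from bezout_pow_left[OF this, of "n + 1"] obtain u v where "v * ?Y + u * ?X ^ (n + 1) = 1"
      by (metis add.commute)
    from bezout_pow_left[OF this, of "n + 1"] show ?thesis using that by blast
  qed
  ultimately show ?thesis
    unfolding power_mult_distrib by (intro bezout_mult_dvd)
qed

text \<open>Reduces both cases to a single harmonic sum. By \<open>F\<close>, the product
  \<open>M * Q\<close> has only one coefficient from degree 2n + 2 on that can be nonzero modulo
  \<open>p^m\<close>, so \<open>Q\<close> is congruent to the constant \<open>?c\<close>. Cancelling
  p^(2n+2) leaves the exponent \<open>l\<close>.\<close>

lemma rat_cong_gbinomial_iff:
  assumes p: "prime p" "odd p" and np: "n < p" and m: "m = 2 * n + 2 + l"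
    and F: "\<And>i. 2 * n + 3 \<le> i \<Longrightarrow> of_nat p ^ i * elem_harmonic i (p - 1) \<in> padic_ideal p m"
  shows "rat_cong p m (of_int (k * int p - 1) gchoose (p - 1))
      (\<Sum>j=0..n. poly (extremal_poly j n) (of_int k) * of_nat p ^ j * elem_harmonic j (p - 1)) \<longleftrightarrow>
    of_int ((k * (k - 1)) ^ (n + 1)) * elem_harmonic (2 * n + 2) (p - 1) \<in> padic_ideal p l"
    (is "rat_cong p m ?L ?S \<longleftrightarrow> _")
proof -
  let ?F = "\<Sum>j\<le>p-1. monom ((- of_nat p) ^ j * elem_harmonic j (p - 1)) j"
  let ?E = "\<Sum>j=0..n. smult (of_nat p ^ j * elem_harmonic j (p - 1)) (extremal_poly j n)"
  let ?c = "of_nat p ^ (2 * n + 2) * elem_harmonic (2 * n + 2) (p - 1) :: rat"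
  define M :: "rat poly" where "M = ([:0, 1:] * [:-1, 1:]) ^ (n + 1)"
  obtain Q where Q: "?F - ?E = M * Q"
    using extremal_remainder_dvd[OF p(2) np] unfolding M_def by (elim dvdE)
  have deg_M: "degree M = 2 * n + 2"
    by (simp add: M_def degree_power_eq del: power_Suc)
  have lead_M: "lead_coeff M = 1"
    unfolding M_def lead_coeff_power by simp
  have int_M: "coeff M i \<in> padic_ideal p 0" for i
  proof -
    have "coeff ([:0, 1:] * [:-1, 1:]) i \<in> padic_ideal p 0" for i
      using of_int_in_padic_ideal_0[OF p(1), of 0] of_int_in_padic_ideal_0[OF p(1), of 1]
        of_int_in_padic_ideal_0[OF p(1), of "-1"]
      by (simp add: coeff_pCons split: nat.split)
    then show ?thesis unfolding M_def by (rule coeff_power_in_padic_ideal_0[OF p(1)])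
  qed
  have deg_E: "degree ?E \<le> 2 * n + 1"
    using is_extremal_poly_extremal_poly[unfolded is_extremal_poly_def]
    by (intro degree_sum_le) (auto intro: order.trans[OF degree_smult_le])
  have coeff_F: "coeff ?F i = (-1) ^ i * (of_nat p ^ i * elem_harmonic i (p - 1))" for i
    by (simp add: coeff_sum power_minus[of "of_nat p"] elem_harmonic_eq_0)
  have coeff_MQ: "coeff (M * Q) i = (-1) ^ i * (of_nat p ^ i * elem_harmonic i (p - 1))"
    if "2 * n + 2 \<le> i" for i
    \<comment> \<open>From degree 2n + 2 on, \<open>?E\<close> has no coefficients, so those of
      \<open>M * Q\<close> are the ones of \<open>?F\<close>.\<close>
    using that deg_E unfolding Q[symmetric] coeff_diff coeff_F by (simp add: coeff_eq_0)
  have sgn: "(-1) ^ i \<in> padic_ideal p 0" for i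
    using of_int_in_padic_ideal_0[OF p(1), of "(-1) ^ i"] by simp
  have elem: "of_nat p ^ i * elem_harmonic i (p - 1) \<in> padic_ideal p 0" for i
    using p(1) prime_gt_0_nat[OF p(1)]
    by (intro padic_ideal_mult_left padic_ideal_power_0 of_nat_in_padic_ideal_0
        elem_harmonic_in_padic_ideal_0) auto
  have F_int: "poly ?F (of_int k) \<in> padic_ideal p 0"
    by (rule poly_in_padic_ideal[OF p(1)]) (unfold coeff_F, rule padic_ideal_mult_left[OF p(1) sgn elem])
  have Q_int: "coeff Q i \<in> padic_ideal p 0" for i
  proof (rule monic_multiple_coeff_in_padic_ideal[OF p(1) lead_M int_M])
    fix i assume "degree M \<le> i"
    then show "coeff (M * Q) i \<in> padic_ideal p 0"
      unfolding deg_M by (simp only: coeff_MQ padic_ideal_mult_left[OF p(1) sgn elem])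
  qed
  have L: "?L = poly ?F (of_int k)"
    unfolding gbinomial_eq_poly_harmonic_poly[OF p(2)] poly_harmonic_poly_sum power_mult_distrib
    by (simp add: poly_sum poly_monom mult_ac)
  have S: "?S = poly ?E (of_int k)"
    by (simp add: poly_sum mult_ac)
  have diff: "?L - ?S = poly M (of_int k) * poly Q (of_int k)"
    unfolding L S poly_mult[symmetric] Q[symmetric] by simp
  have M_int: "poly M (of_int k) \<in> padic_ideal p 0"
    by (intro poly_in_padic_ideal p int_M)
  have L_int: "?L \<in> padic_ideal p 0" unfolding L by (rule F_int)
  moreover have "poly M (of_int k) * poly Q (of_int k) \<in> padic_ideal p 0"
    by (intro padic_ideal_mult_left M_int poly_in_padic_ideal Q_int p)
  \<comment> \<open>The integrality of \<open>?S\<close> is obtained from that of \<open>?L\<close>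
    and of the difference, without inspecting the coefficients of the extremal polynomials.\<close>
  ultimately have "?L - (?L - ?S) \<in> padic_ideal p 0"
    unfolding diff by (rule padic_ideal_diff[OF p(1)])
  then have int: "?L \<in> padic_ideal p 0" "?S \<in> padic_ideal p 0"
    using L_int by simp_all
  have "coeff (Q - [:?c:]) i \<in> padic_ideal p m" for i
  proof (rule monic_multiple_coeff_in_padic_ideal[OF p(1) lead_M int_M])
    fix i assume i: "degree M \<le> i"
    have "coeff (M * (Q - [:?c:])) i = coeff (M * Q) i - coeff M i * ?c"
      by (simp add: algebra_simps)
    also have "\<dots> \<in> padic_ideal p m"
    proof (cases "i = 2 * n + 2")
      case True
      \<comment> \<open>In degree 2n + 2 the sign is even and \<open>M\<close> is monic, so the two
        terms cancel exactly. In higher degrees \<open>M\<close> has no coefficient and the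
        hypothesis \<open>F\<close> applies.\<close>
      then show ?thesis
        using lead_M zero_in_padic_ideal[OF p(1)] unfolding deg_M by (simp add: coeff_MQ)
    next
      case False
      then show ?thesis
        using i F[of i] sgn p(1) unfolding deg_M
        by (simp add: coeff_MQ coeff_eq_0 deg_M padic_ideal_mult_left)
    qed
    finally show "coeff (M * (Q - [:?c:])) i \<in> padic_ideal p m" .
  qed
  then have "poly (Q - [:?c:]) (of_int k) \<in> padic_ideal p m"
    by (intro poly_in_padic_ideal p)
  then have "poly M (of_int k) * poly (Q - [:?c:]) (of_int k) \<in> padic_ideal p m"
    by (intro padic_ideal_mult_left M_int p)
  then have "(?L - ?S) - poly M (of_int k) * ?c \<in> padic_ideal p m"
    unfolding diff by (simp add: algebra_simps)
  moreover have "poly M (of_int k) = of_int ((k * (k - 1)) ^ (n + 1))"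
    by (simp add: M_def algebra_simps del: power_Suc)
  ultimately have "rat_cong p m ?L ?S \<longleftrightarrow> of_int ((k * (k - 1)) ^ (n + 1)) * ?c \<in> padic_ideal p m"
    using rat_cong_iff_padic_ideal[OF p(1) int] padic_ideal_cong[OF p(1)] by simp
  then show ?thesis
    unfolding m mult.left_commute[of _ "of_nat p ^ (2 * n + 2)"] padic_ideal_prime_power_mult_iff[OF p(1)] .
qed

lemma prime_dvd_pow_iff:
  assumes "prime p"
  shows "int p dvd (k * (k - 1)) ^ (n + 1) \<longleftrightarrow> [k = 0] (mod int p) \<or> [k = 1] (mod int p)"
proof -
  have "int p dvd (k * (k - 1)) ^ (n + 1) \<longleftrightarrow> int p dvd k \<or> int p dvd k - 1"
    using assms by (simp add: prime_dvd_power_iff prime_dvd_mult_iff del: power_Suc)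
  then show ?thesis by (simp add: cong_iff_dvd_diff)
qed

theorem theorem1p4:
  fixes n p :: nat and k :: int
  assumes "prime p" and "odd p"
  shows "(p \<ge> 2 * n + 5 \<longrightarrow>
            (rat_cong p (2 * n + 4)
               (of_int (k * int p - 1) gchoose (p - 1))
               (\<Sum>j=0..n. poly (extremal_poly j n) (of_int k) * of_nat p ^ j * elem_harmonic j (p - 1))
             \<longleftrightarrow> [k = 0] (mod int p) \<or> [k = 1] (mod int p) \<or>
                 int p dvd rat_numerator (bernoulli_number (p - 2 * n - 3)))) \<and>
         (p = 2 * n + 3 \<longrightarrow>
            (rat_cong p (2 * n + 3)
               (of_int (k * int p - 1) gchoose (p - 1))
               (\<Sum>j=0..n. poly (extremal_poly j n) (of_int k) * of_nat p ^ j * elem_harmonic j (p - 1))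
             \<longleftrightarrow> [k = 0] (mod int p) \<or> [k = 1] (mod int p)))"
proof (intro conjI impI)
  let ?L = "of_int (k * int p - 1) gchoose (p - 1) :: rat"
  let ?S = "\<Sum>j=0..n. poly (extremal_poly j n) (of_int k) * of_nat p ^ j * elem_harmonic j (p - 1)"
  define a where "a = (k * (k - 1)) ^ (n + 1)"
  let ?H = "\<lambda>j. elem_harmonic j (p - 1)"
  note p = assms(1)
  have unit: "\<not> int p dvd fact (p - 1)"
    using prime_gt_0_nat[OF p] by (intro not_prime_dvd_fact p) simp
  {
    assume np: "p \<ge> 2 * n + 5"
    define r where "r = p - 2 * n - 3"
    let ?B = "bernoulli_number r"
    have r: "0 < r" "r + 2 \<le> p" "r < p" using np by (auto simp: r_def)
    have B: "?B \<in> padic_ideal p 0" by (rule bernoulli_number_in_padic_ideal_0[OF p r(2)])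
    have H: "?H (2 * n + 3) \<in> padic_ideal p 1"
    proof -
      \<comment> \<open>The index p - (2n + 4) is positive because p is at least 2n + 5.\<close>
      have "scaled_harmonic p (p - (2 * n + 4)) \<in> padic_ideal p 1"
        using np by (intro scaled_harmonic_in_padic_ideal_1 scaled_harmonic_cong p) auto
      moreover have "p - 1 - (p - (2 * n + 4)) = 2 * n + 3" using np by simp
      ultimately have "of_int (fact (p - 1)) * ?H (2 * n + 3) \<in> padic_ideal p 1"
        unfolding scaled_harmonic_def by (simp only: of_int_fact)
      then show ?thesis using padic_ideal_unit_mult_iff[OF p unit] by simp
    qed
    have "of_nat p ^ i * ?H i \<in> padic_ideal p (2 * n + 4)" if "2 * n + 3 \<le> i" for i
    proof (cases "i = 2 * n + 3")
      case True
      then show ?thesis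
        using padic_ideal_mult[OF p prime_power_in_padic_ideal[OF p] H, of "2 * n + 3"]
        by (simp add: eval_nat_numeral)
    next
      case False
      have "of_nat p ^ i * ?H i \<in> padic_ideal p i"
        using prime_gt_0_nat[OF p]
        by (intro padic_ideal_mult_right prime_power_in_padic_ideal elem_harmonic_in_padic_ideal_0 p) auto
      then show ?thesis by (rule padic_ideal_mono[OF p]) (use that False in simp)
    qed
    then have "rat_cong p (2 * n + 4) ?L ?S \<longleftrightarrow>
        of_int a * ?H (2 * n + 2) \<in> padic_ideal p 2"
      unfolding a_def using np by (intro rat_cong_gbinomial_iff assms) auto
    \<comment> \<open>As p - 1 - r = 2n + 2, the scaled sum at \<open>r\<close> is (p - 1)! times
      the remaining harmonic sum; the factors \<open>r\<close> and (p - 1)! are units.\<close>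
    also have "\<dots> \<longleftrightarrow> of_int a * (of_nat r * scaled_harmonic p r) \<in> padic_ideal p 2"
    proof -
      have "of_int a * (of_nat r * scaled_harmonic p r) =
          of_int (int r) * (of_int (fact (p - 1)) * (of_int a * ?H (2 * n + 2)))"
        using np by (simp add: scaled_harmonic_def r_def mult_ac)
      then show ?thesis
        by (simp only: padic_ideal_unit_mult_iff[OF p unit]
            padic_ideal_unit_mult_iff[OF p not_dvd_int_if_less[OF r(1,3)]])
    qed
    also have "\<dots> \<longleftrightarrow> of_nat p * (of_int ((-1) ^ Suc r) * (of_int a * ?B)) \<in> padic_ideal p 2"
    proof (rule padic_ideal_cong[OF p])
      have "of_int a * (of_nat r * scaled_harmonic p r + (-1) ^ r * of_nat p * ?B) \<in> padic_ideal p 2"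
        by (intro padic_ideal_mult_left p of_int_in_padic_ideal_0 scaled_harmonic_cong r)
      then show "of_int a * (of_nat r * scaled_harmonic p r) -
          of_nat p * (of_int ((-1) ^ Suc r) * (of_int a * ?B)) \<in> padic_ideal p 2"
        by (simp add: algebra_simps)
    qed
    also have "\<dots> \<longleftrightarrow> of_int a * ?B \<in> padic_ideal p 1"
    proof -
      have "\<not> int p dvd (-1) ^ Suc r" using prime_gt_1_nat[OF p] by (simp add: uminus_power_if)
      then show ?thesis
        using padic_ideal_unit_mult_iff[OF p] padic_ideal_prime_mult_iff[OF p, of _ 1]
        by (simp only: numeral_2_eq_2 One_nat_def)
    qed
    also have "\<dots> \<longleftrightarrow> [k = 0] (mod int p) \<or> [k = 1] (mod int p) \<or> int p dvd rat_numerator ?B"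
      unfolding padic_ideal_1_mult_iff[OF p B] a_def prime_dvd_pow_iff[OF p] by (simp only: disj_assoc)
    finally show "rat_cong p (2 * n + 4) ?L ?S \<longleftrightarrow> [k = 0] (mod int p) \<or> [k = 1] (mod int p) \<or>
        int p dvd rat_numerator (bernoulli_number (p - 2 * n - 3))"
      by (simp only: r_def)
  next
    assume np: "p = 2 * n + 3"
    \<comment> \<open>Here i exceeds p - 1 = 2n + 2, so the harmonic sum is zero.\<close>
    have "of_nat p ^ i * ?H i \<in> padic_ideal p (2 * n + 3)" if "2 * n + 3 \<le> i" for i
      using that np p by (simp add: elem_harmonic_eq_0 zero_in_padic_ideal)
    then have "rat_cong p (2 * n + 3) ?L ?S \<longleftrightarrow>
        of_int a * ?H (2 * n + 2) \<in> padic_ideal p 1"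
      unfolding a_def using np by (intro rat_cong_gbinomial_iff assms) auto
    also have "\<dots> \<longleftrightarrow> of_int (fact (p - 1)) * (of_int a * ?H (2 * n + 2)) \<in> padic_ideal p 1"
      by (rule padic_ideal_unit_mult_iff[OF p unit, symmetric])
    also have "of_int (fact (p - 1)) * (of_int a * ?H (2 * n + 2)) = of_int a * 1"
      using np elem_harmonic_diag[of "2 * n + 2"] by simp
    also have "of_int a * 1 \<in> padic_ideal p 1 \<longleftrightarrow> int p dvd a"
    proof -
      have "1 \<in> padic_ideal p 0" using of_int_in_padic_ideal_0[OF p, of 1] by simp
      moreover have "\<not> int p dvd rat_numerator 1"
        using prime_gt_1_nat[OF p] by (simp add: rat_numerator_def)
      ultimately show ?thesis using padic_ideal_1_mult_iff[OF p] by blast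
    qed
    also have "\<dots> \<longleftrightarrow> [k = 0] (mod int p) \<or> [k = 1] (mod int p)"
      unfolding a_def by (rule prime_dvd_pow_iff[OF p])
    finally show "rat_cong p (2 * n + 3) ?L ?S \<longleftrightarrow> [k = 0] (mod int p) \<or> [k = 1] (mod int p)" .
  }
qed

end
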